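(* For $\mathbb{P}_n,$ $n\neq 4,7$ $$d_{td}(a_i)=\begin{cases} \frac{n}{2}+1 &\text{ if } n \equiv 2 ( mod 4)\\ \frac{n+1}{2} & \text{ if } n\equiv 1(mod 4) \text{ and } i\not\equiv 1(mod 4)\\ \frac{n+1}{2}+1 & \text{ if } n\equiv 1(mod 4) \text{ and } i\equiv 1(mod 4)\\ \frac{n+1}{2} & \text{ if } n\equiv 3(mod 4) \text{ and } i\not\equiv 0(mod 4)\\ \frac{n+1}{2}+1 & \text{ if } n\equiv 3(mod 4) \text{ and } i\equiv 0(mod 4)\\ \frac{n}{2} & \text{ if } n\equiv 0(mod 4) \text{ and } i\equiv 2,3(mod 4)\\ \frac{n}{2}+1 & \text{ if } n\equiv 0(mod 4) \text{ and } i\equiv 0,1(mod 4) \end{cases}$$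
   Context: For a graph without isolated vertices, a total dominating set (TDS) is a set $S$ of vertices such that every vertex of the graph is adjacent to some vertex of $S$; a minimal TDS (MTDS) is a TDS no proper subset of which is a TDS. A vertex is compliant if some MTDS contains it, and a graph is compliant if all its vertices are compliant (the paths $\mathbb{P}_n$, $n\neq 4,7$, are compliant). For a vertex $a$ of a compliant graph, the total domination degree is $d_{td}(a)=\min\{|S| : S \text{ is an MTDS containing } a\}$. The path $\mathbb{P}_n$ has vertices $a_1,a_2,\dots,a_n$ in order. *)

theory Defs
  imports Complex_Main "Graph_Theory.Pair_Digraph"
begin

(* Graphs are symmetric loop-free digraphs (the locale graph); u and v are adjacent
   iff G has an arc from u to v. *)

definition total_dominating_set :: "('a, 'b) pre_digraph \<Rightarrow> 'a set \<Rightarrow> bool" where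
  "total_dominating_set G S \<longleftrightarrow> S \<subseteq> verts G \<and> (\<forall>v \<in> verts G. \<exists>u \<in> S. v \<rightarrow>\<^bsub>G\<^esub> u)"

definition minimal_tds :: "('a, 'b) pre_digraph \<Rightarrow> 'a set \<Rightarrow> bool" where
  "minimal_tds G S \<longleftrightarrow> total_dominating_set G S \<and> (\<forall>T. T \<subset> S \<longrightarrow> \<not> total_dominating_set G T)"

(* Meaningful only for compliant vertices, i.e. those contained in some minimal total
   dominating set: otherwise the set is empty and Min is unspecified. *)
definition td_degree :: "('a, 'b) pre_digraph \<Rightarrow> 'a \<Rightarrow> nat" where
  "td_degree G a = Min {card S | S. minimal_tds G S \<and> a \<in> S}"

definition path_graph :: "nat \<Rightarrow> (nat, nat \<times> nat) pre_digraph" where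
  "path_graph n = with_proj
     \<lparr> pverts = {1..n},
       parcs = {(i, j). i \<in> {1..n} \<and> j \<in> {1..n} \<and> (j = i + 1 \<or> i = j + 1)} \<rparr>"

lemma verts_path_graph [simp]: "verts (path_graph n) = {1..n}"
  by (simp add: path_graph_def)

lemma path_graph_adj:
  "i \<rightarrow>\<^bsub>path_graph n\<^esub> j \<longleftrightarrow> i \<in> {1..n} \<and> j \<in> {1..n} \<and> (j = i + 1 \<or> i = j + 1)"
  by (simp add: path_graph_def)

lemma graph_path_graph: "graph (path_graph n)"
proof -
  have "finite {(i, j). i \<in> {1..n} \<and> j \<in> {1..n} \<and> (j = i + 1 \<or> i = j + 1)}"
    by (rule finite_subset [of _ "{1..n} \<times> {1..n}"]) auto
  then show ?thesis
    unfolding path_graph_def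
    by (intro pair_graph.pair_graphD_graph) (unfold_locales, auto simp: symmetric_def sym_def)
qed

lemma path_graph_no_isolated:
  assumes "2 \<le> n" and "i \<in> verts (path_graph n)"
  shows "\<exists>j. i \<rightarrow>\<^bsub>path_graph n\<^esub> j"
proof (cases "i = 1")
  case True
  with assms have "i \<rightarrow>\<^bsub>path_graph n\<^esub> 2"
    by (simp add: path_graph_adj)
  then show ?thesis ..
next
  case False
  with assms have "i \<rightarrow>\<^bsub>path_graph n\<^esub> (i - 1)"
    by (auto simp: path_graph_adj)
  then show ?thesis ..
qed

end

theory Submission
  imports Defs
begin

(* An open packing D (no two of its vertices at distance two) has pairwise disjoint open
   neighbourhoods, each of which meets every total dominating set; if moreover i is adjacent to
   no vertex of D, then a total dominating set through i has more than card D elements.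
   Conversely, a total dominating set S in which i has a private neighbour shrinks to a minimal
   one still containing i. So a pair (S, D) with card S = card D + 1 certifies the value of the
   total domination degree. Certificates propagate from length n to n + 4 by adding a block of four
   vertices at either end, which leaves finitely many base cases. The induction has to
   include the compliant vertices of the paths on 4 and 7 vertices. *)

lemma critical_vertex_in_minimal_tds:
  assumes "total_dominating_set G S" "finite S"
    and "v \<in> verts G" and priv: "\<And>u. u \<in> S \<Longrightarrow> v \<rightarrow>\<^bsub>G\<^esub> u \<Longrightarrow> u = a"
  obtains T where "minimal_tds G T" "T \<subseteq> S" "a \<in> T"
proof -
  let ?F = "{T. T \<subseteq> S \<and> total_dominating_set G T}"
  have "finite ?F" "S \<in> ?F"
    using assms(1,2) by auto
  from finite_has_minimal2 [OF this] obtain T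
    where T: "T \<in> ?F" and min: "\<forall>T' \<in> ?F. T' \<subseteq> T \<longrightarrow> T = T'"
    by blast
  have "\<not> total_dominating_set G T'" if "T' \<subset> T" for T'
    using that T min by blast
  with T have "minimal_tds G T"
    by (simp add: minimal_tds_def)
  \<comment> \<open>\<open>T\<close> must still dominate \<open>v\<close>, and inside
    \<open>S\<close> only \<open>a\<close> can do that, so no shrinking removes
    \<open>a\<close>.\<close>
  moreover obtain u where "u \<in> T" "v \<rightarrow>\<^bsub>G\<^esub> u"
    using T \<open>v \<in> verts G\<close> unfolding total_dominating_set_def by blast
  moreover from this have "u = a"
    using T priv by blast
  ultimately show thesis
    using T that by blast
qed

text \<open>In this bounded arithmetic form, free of the graph, total domination of a short path by
  an explicit set can be decided by evaluation.\<close>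

lemma total_dominating_set_path_iff:
  "total_dominating_set (path_graph n) S \<longleftrightarrow>
    S \<subseteq> {1..n} \<and> (\<forall>v \<in> {1..n}. \<exists>u \<in> S. u = v + 1 \<or> v = u + 1)"
proof -
  have "(\<exists>u \<in> S. v \<rightarrow>\<^bsub>path_graph n\<^esub> u) \<longleftrightarrow> (\<exists>u \<in> S. u = v + 1 \<or> v = u + 1)"
    if "S \<subseteq> {1..n}" "v \<in> {1..n}" for v
    using that unfolding path_graph_adj by blast
  then show ?thesis
    unfolding total_dominating_set_def verts_path_graph by (metis (no_types, lifting))
qed

text \<open>Choosing for each vertex of \<open>D\<close> a neighbour in \<open>S\<close> is
  injective, since two vertices of a path with a common neighbour are equal or two apart. The image
  misses \<open>i\<close>, which is adjacent to nothing in \<open>D\<close>, so \<open>i\<close>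
  counts as one extra element.\<close>

lemma card_open_packing_less:
  assumes tds: "total_dominating_set (path_graph n) S" and "i \<in> S"
    and "D \<subseteq> {1..n}" and sep: "\<And>x. x \<in> D \<Longrightarrow> x + 2 \<notin> D"
    and avoid: "\<And>x. x \<in> D \<Longrightarrow> x \<noteq> i + 1 \<and> i \<noteq> x + 1"
  shows "card D < card S"
proof -
  have S: "S \<subseteq> {1..n}" "\<And>v. v \<in> {1..n} \<Longrightarrow> \<exists>u \<in> S. u = v + 1 \<or> v = u + 1"
    using tds by (auto simp: total_dominating_set_path_iff)
  then have "\<forall>x \<in> D. \<exists>u. u \<in> S \<and> (u = x + 1 \<or> x = u + 1)"
    using \<open>D \<subseteq> {1..n}\<close> by blast
  then obtain f where f: "\<And>x. x \<in> D \<Longrightarrow> f x \<in> S \<and> (f x = x + 1 \<or> x = f x + 1)"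
    by metis
  have "inj_on f D"
  proof (rule inj_onI)
    fix x y assume "x \<in> D" "y \<in> D" "f x = f y"
    then have "x = y \<or> x = y + 2 \<or> y = x + 2"
      using f [of x] f [of y] by auto
    then show "x = y"
      using sep \<open>x \<in> D\<close> \<open>y \<in> D\<close> by blast
  qed
  moreover have "i \<notin> f ` D"
    using f avoid by blast
  moreover have "finite S" "f ` D \<subseteq> S"
    using S(1) f by (auto intro: finite_subset)
  ultimately show ?thesis
    using \<open>i \<in> S\<close> by (metis card_image psubsetI psubset_card_mono)
qed

text \<open>The vertex \<open>p\<close> is a private neighbour of \<open>i\<close>. The vertex
  \<open>i\<close> may itself belong to \<open>D\<close>: only its neighbours are excluded. The last
  two equations make the upper bound from \<open>S\<close> and the lower bound from \<open>D\<close>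
  meet at \<open>k\<close>.\<close>

definition td_certificate :: "nat \<Rightarrow> nat \<Rightarrow> nat \<Rightarrow> nat set \<Rightarrow> nat set \<Rightarrow> bool" where
  "td_certificate n i k S D \<longleftrightarrow>
    total_dominating_set (path_graph n) S \<and> i \<in> S \<and>
    (\<exists>p \<in> {1..n}. \<forall>u \<in> S. u = p + 1 \<or> p = u + 1 \<longrightarrow> u = i) \<and>
    D \<subseteq> {1..n} \<and> (\<forall>x \<in> D. x + 2 \<notin> D) \<and> (\<forall>x \<in> D. x \<noteq> i + 1 \<and> i \<noteq> x + 1) \<and>
    card S = k \<and> card D + 1 = k"

lemma td_degree_certificate:
  assumes "td_certificate n i k S D"
  shows "td_degree (path_graph n) i = k"
proof -
  let ?M = "{card S | S. minimal_tds (path_graph n) S \<and> i \<in> S}"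
  have S: "total_dominating_set (path_graph n) S" "S \<subseteq> {1..n}" "card S = k"
    and "\<exists>p \<in> {1..n}. \<forall>u \<in> S. u = p + 1 \<or> p = u + 1 \<longrightarrow> u = i"
    using assms unfolding td_certificate_def total_dominating_set_path_iff by (elim conjE, simp)+
  then obtain p where p: "p \<in> {1..n}" "\<forall>u \<in> S. u = p + 1 \<or> p = u + 1 \<longrightarrow> u = i" by blast
  have lower: "k \<le> card T" if "total_dominating_set (path_graph n) T" "i \<in> T" for T
    using card_open_packing_less [OF that, of D] assms by (simp add: td_certificate_def)
  obtain T where T: "minimal_tds (path_graph n) T" "T \<subseteq> S" "i \<in> T"
  proof (rule critical_vertex_in_minimal_tds [of "path_graph n" S p i])
    show "finite S"
      using S(2) by (rule finite_subset) simp
  qed (use S p in \<open>auto simp: path_graph_adj\<close>)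
  \<comment> \<open>Inclusion in \<open>S\<close> bounds \<open>card T\<close> from above, the
    packing from below; in fact \<open>T\<close> is then all of \<open>S\<close>.\<close>
  have "card T = k"
    using lower [of T] T \<open>card S = k\<close> card_mono [of S T] finite_subset [OF S(2)]
    by (auto simp: minimal_tds_def)
  then have "k \<in> ?M"
    using T by (intro CollectI exI [of _ T]) simp
  moreover have "\<And>m. m \<in> ?M \<Longrightarrow> k \<le> m"
    using lower by (auto simp: minimal_tds_def)
  \<comment> \<open>Together with \<open>k\<close> \<in> \<open>?M\<close>, this makes
    \<open>Min\<close> a genuine minimum.\<close>
  moreover have "finite ?M"
  proof (rule finite_subset)
    show "?M \<subseteq> card ` Pow {1..n}"
      unfolding minimal_tds_def total_dominating_set_def verts_path_graph by blast
  qed simp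
  ultimately show ?thesis
    unfolding td_degree_def by (intro Min_eqI)
qed

text \<open>The middle two of the new vertices dominate the whole block and, starting at
  \<open>n + 2\<close>, are not adjacent to the old \<open>p\<close>. The packing takes the outer
  two, which are too far away to be at distance two from \<open>D\<close> or adjacent to
  \<open>i\<close>.\<close>

lemma td_certificate_extend_right:
  assumes "td_certificate n i k S D"
  shows "td_certificate (n + 4) i (k + 2) (S \<union> {n + 2, n + 3}) (D \<union> {n + 3, n + 4})"
proof -
  have S: "S \<subseteq> {1..n}" "i \<in> S" and D: "D \<subseteq> {1..n}"
    and dom: "\<And>v. v \<in> {1..n} \<Longrightarrow> \<exists>u \<in> S. u = v + 1 \<or> v = u + 1"
    and sep: "\<And>x. x \<in> D \<Longrightarrow> x + 2 \<notin> D" "\<And>x. x \<in> D \<Longrightarrow> x \<noteq> i + 1 \<and> i \<noteq> x + 1"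
    and card: "card S = k" "card D + 1 = k"
    using assms by (auto simp: td_certificate_def total_dominating_set_path_iff)
  have "\<exists>p \<in> {1..n}. \<forall>u \<in> S. u = p + 1 \<or> p = u + 1 \<longrightarrow> u = i"
    using assms unfolding td_certificate_def by (elim conjE)
  then obtain p where p: "p \<in> {1..n}" "\<forall>u \<in> S. u = p + 1 \<or> p = u + 1 \<longrightarrow> u = i" ..
  have fin: "finite S" "finite D"
    using S D by (auto intro: finite_subset)
  have "S \<inter> {n + 2, n + 3} = {}" "D \<inter> {n + 3, n + 4} = {}"
    using S D by auto
  then have cards: "card (S \<union> {n + 2, n + 3}) = card S + 2" "card (D \<union> {n + 3, n + 4}) = card D + 2"
    using fin by (simp_all add: card_Un_disjoint)
  have dom': "\<exists>u \<in> S \<union> {n + 2, n + 3}. u = v + 1 \<or> v = u + 1" if "v \<in> {1..n + 4}" for v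
  proof (cases "v \<le> n")
    case True
    then show ?thesis using dom [of v] that by auto
  next
    case False
    then have "v = n + 1 \<or> v = n + 2 \<or> v = n + 3 \<or> v = n + 4"
      using that by auto
    then show ?thesis by auto
  qed
  have tds: "total_dominating_set (path_graph (n + 4)) (S \<union> {n + 2, n + 3})"
    unfolding total_dominating_set_path_iff using dom' S by fastforce
  have priv: "\<exists>p \<in> {1..n + 4}. \<forall>u \<in> S \<union> {n + 2, n + 3}. u = p + 1 \<or> p = u + 1 \<longrightarrow> u = i"
    using p by (intro bexI [of _ p]) auto
  have "\<forall>x \<in> D \<union> {n + 3, n + 4}. x + 2 \<notin> D \<union> {n + 3, n + 4}"
    using D sep(1) by fastforce
  moreover have "\<forall>x \<in> D \<union> {n + 3, n + 4}. x \<noteq> i + 1 \<and> i \<noteq> x + 1"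
    using S sep(2) by fastforce
  moreover have "D \<union> {n + 3, n + 4} \<subseteq> {1..n + 4}"
    using D by auto
  ultimately show "td_certificate (n + 4) i (k + 2) (S \<union> {n + 2, n + 3}) (D \<union> {n + 3, n + 4})"
    unfolding td_certificate_def using tds priv S card cards by simp
qed

text \<open>Mirror image of the extension on the right: the old certificate moves up by four, and
  the packing again takes the two block vertices farthest from it.\<close>

lemma td_certificate_extend_left:
  assumes "td_certificate n i k S D"
  shows "td_certificate (n + 4) (i + 4) (k + 2) ({2, 3} \<union> (\<lambda>x. x + 4) ` S) ({1, 2} \<union> (\<lambda>x. x + 4) ` D)"
proof -
  let ?S = "{2, 3} \<union> (\<lambda>x. x + 4) ` S" and ?D = "{1, 2} \<union> (\<lambda>x. x + 4) ` D"
  have S: "S \<subseteq> {1..n}" "i \<in> S" and D: "D \<subseteq> {1..n}"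
    and dom: "\<And>v. v \<in> {1..n} \<Longrightarrow> \<exists>u \<in> S. u = v + 1 \<or> v = u + 1"
    and sep: "\<And>x. x \<in> D \<Longrightarrow> x + 2 \<notin> D" "\<And>x. x \<in> D \<Longrightarrow> x \<noteq> i + 1 \<and> i \<noteq> x + 1"
    and card: "card S = k" "card D + 1 = k"
    using assms by (auto simp: td_certificate_def total_dominating_set_path_iff)
  have "\<exists>p \<in> {1..n}. \<forall>u \<in> S. u = p + 1 \<or> p = u + 1 \<longrightarrow> u = i"
    using assms unfolding td_certificate_def by (elim conjE)
  then obtain p where p: "p \<in> {1..n}" "\<forall>u \<in> S. u = p + 1 \<or> p = u + 1 \<longrightarrow> u = i" ..
  have fin: "finite S" "finite D"
    using S D by (auto intro: finite_subset)
  have "{2, 3} \<inter> (\<lambda>x. x + 4) ` S = {}" "{1, 2} \<inter> (\<lambda>x. x + 4) ` D = {}"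
    by auto
  moreover have "card ((\<lambda>x. x + 4) ` A) = card A" for A :: "nat set"
    by (simp add: card_image)
  ultimately have cards: "card ?S = card S + 2" "card ?D = card D + 2"
    using fin by (simp_all add: card_Un_disjoint del: Un_insert_left)
  have dom': "\<exists>u \<in> ?S. u = v + 1 \<or> v = u + 1" if v: "v \<in> {1..n + 4}" for v
  proof (cases "v \<le> 4")
    case True
    then have "v = 1 \<or> v = 2 \<or> v = 3 \<or> v = 4"
      using v by auto
    then show ?thesis by auto
  next
    case False
    then have "v - 4 \<in> {1..n}"
      using v by auto
    then obtain u where "u \<in> S" "u = v - 4 + 1 \<or> v - 4 = u + 1"
      using dom by blast
    then show ?thesis
      using False by (intro bexI [of _ "u + 4"]) auto
  qed
  have tds: "total_dominating_set (path_graph (n + 4)) ?S"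
    unfolding total_dominating_set_path_iff using dom' S by fastforce
  have priv: "\<exists>p \<in> {1..n + 4}. \<forall>u \<in> ?S. u = p + 1 \<or> p = u + 1 \<longrightarrow> u = i + 4"
    using p by (intro bexI [of _ "p + 4"]) auto
  have "\<forall>x \<in> ?D. x + 2 \<notin> ?D"
    using D sep(1) by fastforce
  moreover have "\<forall>x \<in> ?D. x \<noteq> i + 4 + 1 \<and> i + 4 \<noteq> x + 1"
    using S sep(2) by fastforce
  moreover have "?D \<subseteq> {1..n + 4}"
    using D by auto
  ultimately show "td_certificate (n + 4) (i + 4) (k + 2) ?S ?D"
    unfolding td_certificate_def using tds priv S card cards by simp
qed

text \<open>The claimed formula in natural numbers, to be compared with the \<open>k\<close> of a
  certificate. It is also correct at the compliant vertices of the paths on 4 and 7 vertices,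
  through which the induction passes.\<close>

definition path_td_value :: "nat \<Rightarrow> nat \<Rightarrow> nat" where
  "path_td_value n i =
    (if n mod 4 = 2 then n div 2 + 1
     else if n mod 4 = 1 then (n + 1) div 2 + (if i mod 4 = 1 then 1 else 0)
     else if n mod 4 = 3 then (n + 1) div 2 + (if i mod 4 = 0 then 1 else 0)
     else n div 2 + (if i mod 4 \<in> {0, 1} then 1 else 0))"

text \<open>The growth by 2 is that of \<open>k\<close> in both extensions; periodicity in
  \<open>i\<close> absorbs the shift of the left one.\<close>

lemma path_td_value_add4:
  "path_td_value (n + 4) i = path_td_value n i + 2"
  "path_td_value n (i + 4) = path_td_value n i"
proof -
  have "(n + 4) div 2 = n div 2 + 2" "(n + 4 + 1) div 2 = (n + 1) div 2 + 2"
    by linarith+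
  then show "path_td_value (n + 4) i = path_td_value n i + 2"
    unfolding path_td_value_def by simp
qed (simp add: path_td_value_def)

text \<open>These are the compliant pairs (n, i) that no extension reaches: removing four vertices
  at either end leaves fewer than two vertices, deletes \<open>i\<close>, or produces (4, 1), (4, 4)
  or (7, 4). The last obstruction accounts for the cases with n = 8 and n = 11.\<close>

lemma td_certificate_base:
  shows "td_certificate 2 1 2 {1, 2} {1}"
  and "td_certificate 2 2 2 {1, 2} {2}"
  and "td_certificate 3 1 2 {1, 2} {1}"
  and "td_certificate 3 2 2 {1, 2} {2}"
  and "td_certificate 3 3 2 {2, 3} {1}"
  and "td_certificate 4 2 2 {2, 3} {2}"
  and "td_certificate 4 3 2 {2, 3} {1}"
  and "td_certificate 5 1 4 {1, 2, 4, 5} {1, 4, 5}"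
  and "td_certificate 5 2 3 {2, 3, 4} {2, 5}"
  and "td_certificate 5 3 3 {2, 3, 4} {1, 5}"
  and "td_certificate 5 4 3 {2, 3, 4} {1, 2}"
  and "td_certificate 5 5 4 {1, 2, 4, 5} {1, 2, 5}"
  and "td_certificate 6 3 4 {2, 3, 4, 5} {1, 5, 6}"
  and "td_certificate 6 4 4 {1, 2, 4, 5} {1, 2, 6}"
  and "td_certificate 8 1 5 {1, 2, 5, 6, 7} {1, 4, 5, 8}"
  and "td_certificate 8 4 5 {2, 3, 4, 7, 8} {1, 2, 6, 7}"
  and "td_certificate 8 5 5 {1, 2, 5, 6, 7} {1, 2, 5, 8}"
  and "td_certificate 8 8 5 {2, 3, 4, 7, 8} {1, 2, 5, 6}"
  and "td_certificate 11 4 7 {1, 2, 4, 5, 8, 9, 10} {1, 2, 6, 7, 10, 11}"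
  and "td_certificate 11 8 7 {1, 2, 4, 5, 8, 9, 10} {1, 2, 5, 6, 10, 11}"
  unfolding td_certificate_def total_dominating_set_path_iff by code_simp+

text \<open>The three excluded pairs are the non-compliant vertices. Excluding n = 4 and n = 7
  altogether would break the induction: (8, 2), for instance, can only come from (4, 2).\<close>

lemma td_certificate_exists:
  assumes "2 \<le> n" "i \<in> {1..n}" "(n, i) \<notin> {(4, 1), (4, 4), (7, 4)}"
  shows "\<exists>S D. td_certificate n i (path_td_value n i) S D"
  using assms
proof (induction n arbitrary: i rule: less_induct)
  case (less n)
  have right: ?case
    if nm: "n = m + 4" and m: "2 \<le> m" "i \<in> {1..m}" "(m, i) \<notin> {(4, 1), (4, 4), (7, 4)}" for m
  proof -
    obtain S D where "td_certificate m i (path_td_value m i) S D"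
      using less.IH [of m i] nm m by auto
    from td_certificate_extend_right [OF this] show ?thesis
      unfolding nm path_td_value_add4 by blast
  qed
  have left: ?case
    if nm: "n = m + 4" "i = j + 4" and m: "2 \<le> m" "j \<in> {1..m}" "(m, j) \<notin> {(4, 1), (4, 4), (7, 4)}"
    for m j
  proof -
    obtain S D where "td_certificate m j (path_td_value m j) S D"
      using less.IH [of m j] nm m by auto
    from td_certificate_extend_left [OF this] show ?thesis
      unfolding nm path_td_value_add4 by blast
  qed
  let ?exceptions = "{(4, 1), (4, 4), (7, 4)} :: (nat \<times> nat) set"
  let ?base = "{(2, 1), (2, 2), (3, 1), (3, 2), (3, 3), (4, 2), (4, 3),
    (5, 1), (5, 2), (5, 3), (5, 4), (5, 5), (6, 3), (6, 4),
    (8, 1), (8, 4), (8, 5), (8, 8), (11, 4), (11, 8)} :: (nat \<times> nat) set"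
  \<comment> \<open>Either the pair is a base case, or a block can be stripped at the right end or
    at the left end without meeting an exception.\<close>
  have "(n, i) \<in> ?base \<or>
      6 \<le> n \<and> i + 4 \<le> n \<and> (n - 4, i) \<notin> ?exceptions \<or>
      6 \<le> n \<and> 5 \<le> i \<and> (n - 4, i - 4) \<notin> ?exceptions"
  proof (cases "n \<le> 11")
    case True
    then have "n = 2 \<or> n = 3 \<or> n = 4 \<or> n = 5 \<or> n = 6 \<or> n = 7 \<or> n = 8 \<or> n = 9 \<or> n = 10 \<or> n = 11"
      using less.prems(1) by presburger
    moreover have "1 \<le> i" "i \<le> n" "(n, i) \<notin> ?exceptions"
      using less.prems by (simp_all del: One_nat_def)
    ultimately show ?thesis
      unfolding insert_iff empty_iff prod.inject by (elim disjE; hypsubst; simp; presburger)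
  next
    case False
    \<comment> \<open>Now \<open>n - 4\<close> is at least 8, beyond all exceptions, so it suffices
      that \<open>i\<close> survives at one of the ends; this holds because \<open>n\<close> is at
      least 8.\<close>
    then have "6 \<le> n" "n - 4 \<noteq> 4" "n - 4 \<noteq> 7" "i + 4 \<le> n \<or> 5 \<le> i"
      by linarith+
    then show ?thesis
      by auto
  qed
  then show ?case
  proof (elim disjE conjE)
    assume "(n, i) \<in> ?base"
    then show ?thesis
      by (elim insertE emptyE; unfold prod.inject; elim conjE; hypsubst;
          simp add: path_td_value_def del: One_nat_def; blast intro: td_certificate_base)
  next
    assume "6 \<le> n" "i + 4 \<le> n" "(n - 4, i) \<notin> ?exceptions"
    then show ?thesis
      using right [of "n - 4"] less.prems(2) by simp
  next
    assume *: "6 \<le> n" "5 \<le> i" "(n - 4, i - 4) \<notin> ?exceptions"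
    then have "n = n - 4 + 4" "i = i - 4 + 4" "2 \<le> n - 4" "i - 4 \<in> {1..n - 4}"
      using less.prems(2) by auto
    then show ?thesis
      using *(3) by (rule left)
  qed
qed

theorem theorem4:
  fixes n i :: nat
  assumes "2 \<le> n" and "n \<noteq> 4" and "n \<noteq> 7"
    and "i \<in> verts (path_graph n)"
  shows "(n mod 4 = 2 \<longrightarrow>
            real (td_degree (path_graph n) i) = real n / 2 + 1) \<and>
         (n mod 4 = 1 \<and> i mod 4 \<noteq> 1 \<longrightarrow>
            real (td_degree (path_graph n) i) = (real n + 1) / 2) \<and>
         (n mod 4 = 1 \<and> i mod 4 = 1 \<longrightarrow>
            real (td_degree (path_graph n) i) = (real n + 1) / 2 + 1) \<and>
         (n mod 4 = 3 \<and> i mod 4 \<noteq> 0 \<longrightarrow>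
            real (td_degree (path_graph n) i) = (real n + 1) / 2) \<and>
         (n mod 4 = 3 \<and> i mod 4 = 0 \<longrightarrow>
            real (td_degree (path_graph n) i) = (real n + 1) / 2 + 1) \<and>
         (n mod 4 = 0 \<and> i mod 4 \<in> {2, 3} \<longrightarrow>
            real (td_degree (path_graph n) i) = real n / 2) \<and>
         (n mod 4 = 0 \<and> i mod 4 \<in> {0, 1} \<longrightarrow>
            real (td_degree (path_graph n) i) = real n / 2 + 1)"
proof -
  have "td_degree (path_graph n) i = path_td_value n i"
    using td_certificate_exists [of n i] assms td_degree_certificate by fastforce
  \<comment> \<open>In each residue class the number being halved is even, so the truncated division
    is exact.\<close>
  moreover have "real (n div 2) = real n / 2" if "n mod 4 = 0 \<or> n mod 4 = 2"
    using that by (subst real_of_nat_div) (presburger, simp)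
  moreover have "real ((n + 1) div 2) = (real n + 1) / 2" if "n mod 4 = 1 \<or> n mod 4 = 3"
    using that by (subst real_of_nat_div) (presburger, simp)
  ultimately show ?thesis
    by (auto simp: path_td_value_def simp del: add_2_eq_Suc' add_Suc_right One_nat_def)
qed

end
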